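(* Let $V$ be a vertex algebra and $n\ge1$ an integer. Let $\mathrm{Der}_{N=n}(V)$ be the set of all $N=n$ SUSY structures of $V$, i.e. the set of $n$-tuples $(D^1,\dots,D^n)$ of odd derivations of the normally ordered product and the $\lambda$-bracket of $V$ satisfying $[D^i,D^j]=2\delta_{ij}\partial$. Then $\mathrm{Der}_{N=n}(V)$ admits an action of the (complex) orthogonal group in dimension $n$.
   Context: $V$ is a vertex (super)algebra over $\mathbb{C}$ with translation operator $\partial$, $\lambda$-bracket $[a\,{}_\lambda\,b]=\sum_{m\ge0}\frac{\lambda^m}{m!}a_{(m)}b$ and normally ordered product $:ab:$; $p$ is parity. An odd derivation $D$ of the normally ordered product and of the $\lambda$-bracket is an odd linear operator with $D(:ab:)=\,:(Da)b:+(-1)^{p(a)}:a(Db):$ and $D[a\,{}_\lambda\,b]=[Da\,{}_\lambda\,b]+(-1)^{p(a)}[a\,{}_\lambda\,Db]$ (where $D$ commutes with $\lambda$). $[D^i,D^j]=D^iD^j+D^jD^i$ is the supercommutator. The complex orthogonal group in dimension $n$ is $\mathbf O_n(\mathbb{C})=\{A\in GL_n(\mathbb{C})\mid AA^T=1\}$. *)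

theory Defs
  imports "HOL-Analysis.Analysis" "HOL-Algebra.Group_Action" "HOL-Library.Z2"
begin

text \<open>Parities live in the two-element field \<^typ>\<open>bit\<close>; \<open>parity_sign p x\<close> is $(-1)^p x$.\<close>

definition parity_sign :: "bit \<Rightarrow> 'a::uminus \<Rightarrow> 'a" where
  "parity_sign p x = (if p = 1 then - x else x)"

text \<open>
  \<open>V p\<close> is the homogeneous component of parity \<open>p\<close>, \<open>T\<close> is the translation operator,
  and \<open>Y a n b\<close> is the $n$-th product $a_{(n)} b$, so that the field attached to \<open>a\<close> is
  $Y(a,z) = \sum_n a_{(n)} z^{-n-1}$. The axioms on fields are written out on Fourier coefficients;
  \<open>translation\<close> is $[T, Y(a,z)] = \partial_z Y(a,z)$, and \<open>locality\<close> is
  $(z-w)^N [Y(a,z), Y(b,w)] = 0$ with the supercommutator, read off at $z^{-m-1} w^{-n-1}$.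
\<close>

locale vertex_superalgebra = vector_space smul
  for smul :: "complex \<Rightarrow> 'v::ab_group_add \<Rightarrow> 'v" +
  fixes V :: "bit \<Rightarrow> 'v set"
    and vac :: 'v
    and T :: "'v \<Rightarrow> 'v"
    and Y :: "'v \<Rightarrow> int \<Rightarrow> 'v \<Rightarrow> 'v"
  assumes subspace_V: "\<And>p. subspace (V p)"
    and V_direct: "V 0 \<inter> V 1 = {0}"
    and V_span: "\<And>v. \<exists>x\<in>V 0. \<exists>y\<in>V 1. v = x + y"
    and linear_T: "Vector_Spaces.linear smul smul T"
    and T_even: "\<And>p a. a \<in> V p \<Longrightarrow> T a \<in> V p"
    and linear_Y_left: "\<And>n b. Vector_Spaces.linear smul smul (\<lambda>a. Y a n b)"
    and linear_Y_right: "\<And>a n. Vector_Spaces.linear smul smul (Y a n)"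
    and Y_parity: "\<And>p q a b n. a \<in> V p \<Longrightarrow> b \<in> V q \<Longrightarrow> Y a n b \<in> V (p + q)"
    and Y_field: "\<And>a b. \<exists>N. \<forall>n\<ge>N. Y a n b = 0"
    and vac_even: "vac \<in> V 0"
    and T_vac: "T vac = 0"
    and Y_vac_left: "\<And>n b. Y vac n b = (if n = -1 then b else 0)"
    and Y_vac_right: "\<And>a. Y a (-1) vac = a" "\<And>a n. n \<ge> 0 \<Longrightarrow> Y a n vac = 0"
    and translation: "\<And>a n b. T (Y a n b) - Y a n (T b) = smul (- of_int n) (Y a (n - 1) b)"
    and locality: "\<And>p q a b. a \<in> V p \<Longrightarrow> b \<in> V q \<Longrightarrow>
      \<exists>N::nat. \<forall>m n c.
        (\<Sum>j\<le>N. smul ((-1) ^ j * of_nat (N choose j))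
          (Y a (m + int N - int j) (Y b (n + int j) c)
            - parity_sign (p * q) (Y b (n + int j) (Y a (m + int N - int j) c)))) = 0"

definition normal_product :: "('v \<Rightarrow> int \<Rightarrow> 'v \<Rightarrow> 'v) \<Rightarrow> 'v \<Rightarrow> 'v \<Rightarrow> 'v" where
  "normal_product Y a b = Y a (-1) b"

text \<open>
  The $\lambda$-bracket takes values in $V[\lambda]$, represented by \<^typ>\<open>'v poly\<close>. In a vertex
  superalgebra the coefficient sequence has finite support by \<open>Y_field\<close>, so that \<^const>\<open>Abs_poly\<close>
  is applied within its domain.
\<close>

definition lambda_bracket ::
  "(complex \<Rightarrow> 'v::ab_group_add \<Rightarrow> 'v) \<Rightarrow> ('v \<Rightarrow> int \<Rightarrow> 'v \<Rightarrow> 'v) \<Rightarrow> 'v \<Rightarrow> 'v \<Rightarrow> 'v poly" where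
  "lambda_bracket smul Y a b = Abs_poly (\<lambda>m. smul (1 / fact m) (Y a (int m) b))"

text \<open>\<^term>\<open>map_poly D\<close> is the extension of \<open>D\<close> to $V[\lambda]$ commuting with $\lambda$.\<close>

definition odd_derivation ::
  "(complex \<Rightarrow> 'v::ab_group_add \<Rightarrow> 'v) \<Rightarrow> (bit \<Rightarrow> 'v set) \<Rightarrow> ('v \<Rightarrow> int \<Rightarrow> 'v \<Rightarrow> 'v)
    \<Rightarrow> ('v \<Rightarrow> 'v) \<Rightarrow> bool" where
  "odd_derivation smul V Y D \<longleftrightarrow>
    Vector_Spaces.linear smul smul D \<and>
    (\<forall>p. \<forall>a\<in>V p. D a \<in> V (p + 1)) \<and>
    (\<forall>p. \<forall>a\<in>V p. \<forall>b. D (normal_product Y a b)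
       = normal_product Y (D a) b + parity_sign p (normal_product Y a (D b))) \<and>
    (\<forall>p. \<forall>a\<in>V p. \<forall>b. map_poly D (lambda_bracket smul Y a b)
       = lambda_bracket smul Y (D a) b + parity_sign p (lambda_bracket smul Y a (D b)))"

definition SUSY_structures ::
  "(complex \<Rightarrow> 'v::ab_group_add \<Rightarrow> 'v) \<Rightarrow> (bit \<Rightarrow> 'v set) \<Rightarrow> ('v \<Rightarrow> 'v)
    \<Rightarrow> ('v \<Rightarrow> int \<Rightarrow> 'v \<Rightarrow> 'v) \<Rightarrow> (('v \<Rightarrow> 'v) ^ 'n) set" where
  "SUSY_structures smul V T Y =
    {D. (\<forall>i. odd_derivation smul V Y (D $ i)) \<and>
        (\<forall>i j v. (D $ i) ((D $ j) v) + (D $ j) ((D $ i) v)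
           = (if i = j then smul 2 (T v) else 0))}"

definition orthogonal_group :: "(complex ^ 'n ^ 'n) monoid" where
  "orthogonal_group =
    \<lparr>carrier = {A. invertible A \<and> A ** transpose A = mat 1}, mult = (**), one = mat 1\<rparr>"

end

theory Submission
  imports Defs
begin

text \<open>
  Both Leibniz rules are linear in \<open>D\<close>, so odd derivations are closed under linear combinations.
  Expanding bilinearly, the supercommutators of the tuple $(\sum_j A_{ij} D^j)_i$ are
  $2 (A A^T)_{ij} \partial$, which is $2 \delta_{ij} \partial$ for orthogonal \<open>A\<close>.
\<close>

lemma parity_sign_sum:
  "parity_sign p (sum f A) = (\<Sum>i\<in>A. parity_sign p (f i))" for f :: "'i \<Rightarrow> 'a::ab_group_add"
  by (simp add: parity_sign_def sum_negf)

lemma coeff_parity_sign: "coeff (parity_sign p q) n = parity_sign p (coeff q n)"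
  by (simp add: parity_sign_def)

lemma group_orthogonal_group: "group (orthogonal_group :: (complex ^ 'n ^ 'n) monoid)"
proof (rule groupI)
  fix A B :: "complex ^ 'n ^ 'n"
  assume A: "A \<in> carrier orthogonal_group" and B: "B \<in> carrier orthogonal_group"
  have "(A ** B) ** transpose (A ** B) = A ** (B ** transpose B) ** transpose A"
    by (simp add: matrix_transpose_mul matrix_mul_assoc)
  then show "A \<otimes>\<^bsub>orthogonal_group\<^esub> B \<in> carrier orthogonal_group"
    using A B by (simp add: orthogonal_group_def invertible_mult)
next
  show "\<one>\<^bsub>orthogonal_group\<^esub> \<in> carrier (orthogonal_group :: (complex ^ 'n ^ 'n) monoid)"
    by (simp add: orthogonal_group_def transpose_mat invertible_def)
next
  fix A :: "complex ^ 'n ^ 'n"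
  assume "A \<in> carrier orthogonal_group"
  then have A: "A ** transpose A = mat 1" by (simp add: orthogonal_group_def)
  \<comment> \<open>A one-sided inverse of a square matrix is two-sided, so the transpose is the
    group inverse and is itself orthogonal.\<close>
  then have A': "transpose A ** A = mat 1" by (simp add: matrix_left_right_inverse)
  with A have "transpose A \<in> carrier orthogonal_group"
    by (auto simp: orthogonal_group_def transpose_transpose invertible_def)
  with A' show "\<exists>B\<in>carrier orthogonal_group. B \<otimes>\<^bsub>orthogonal_group\<^esub> A = \<one>\<^bsub>orthogonal_group\<^esub>"
    by (auto simp: orthogonal_group_def)
qed (simp_all add: orthogonal_group_def matrix_mul_assoc)

text \<open>\<open>group_action\<close> asks for a homomorphism into \<open>BijGroup E\<close>,
  whose elements are bijections that are \<open>undefined\<close> outside \<open>E\<close>; hence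
  the restriction of each \<open>f g\<close>.\<close>

lemma (in group) group_action_restrictI:
  assumes closed: "\<And>g x. g \<in> carrier G \<Longrightarrow> x \<in> E \<Longrightarrow> f g x \<in> E"
    and one: "\<And>x. x \<in> E \<Longrightarrow> f \<one> x = x"
    and mult: "\<And>g h x. g \<in> carrier G \<Longrightarrow> h \<in> carrier G \<Longrightarrow> x \<in> E \<Longrightarrow> f (g \<otimes> h) x = f g (f h x)"
  shows "group_action G E (\<lambda>g. restrict (f g) E)"
proof -
  have bij: "restrict (f g) E \<in> Bij E" if g: "g \<in> carrier G" for g
  proof -
    \<comment> \<open>The map \<open>f (inv g)\<close> is inverse to \<open>f g\<close> on
      \<open>E\<close>: by \<open>mult\<close>, both composites are the action of the unit.\<close>
    have "bij_betw (f g) E E"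
      using g by (intro bij_betw_byWitness[where f' = "f (inv g)"])
        (simp_all add: closed one image_subset_iff flip: mult)
    then show ?thesis by (simp add: Bij_def cong: bij_betw_cong)
  qed
  have "(\<lambda>g. restrict (f g) E) \<in> hom G (BijGroup E)"
    by (auto simp: hom_def BijGroup_def bij compose_def closed mult intro!: restrict_ext)
  then show ?thesis
    by (simp add: group_action_def group_hom_def group_hom_axioms_def group_BijGroup group_axioms)
qed

context vertex_superalgebra
begin

lemma parity_sign_scale: "parity_sign p (smul c x) = smul c (parity_sign p x)"
  by (simp add: parity_sign_def)

text \<open>By \<open>Y_field\<close> the products vanish from some index on, so
  \<open>Abs_poly\<close> receives a sequence of finite support and preserves its entries.\<close>

lemma coeff_lambda_bracket:
  "coeff (lambda_bracket smul Y a b) m = smul (1 / fact m) (Y a (int m) b)"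
proof -
  obtain N where "\<forall>n\<ge>N. Y a n b = 0" using Y_field by blast
  then have "smul (1 / fact i) (Y a (int i) b) = 0" if "i > nat N" for i
    using that by simp
  then show ?thesis unfolding lambda_bracket_def by (subst coeff_Abs_poly) auto
qed

text \<open>The normally ordered product is the product of index \<open>-1\<close> and the \<open>\<lambda>\<close>-bracket collects those
  of index \<open>n \<ge> 0\<close>, so both Leibniz rules together are one rule for all \<open>n \<ge> -1\<close>.\<close>

lemma odd_derivation_iff:
  "odd_derivation smul V Y D \<longleftrightarrow>
    Vector_Spaces.linear smul smul D \<and>
    (\<forall>p. \<forall>a\<in>V p. D a \<in> V (p + 1)) \<and>
    (\<forall>p. \<forall>a\<in>V p. \<forall>b. \<forall>n\<ge>-1. D (Y a n b) = Y (D a) n b + parity_sign p (Y a n (D b)))"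
\<comment> \<open>Linearity is a conjunct on both sides. When it holds, \<open>D 0 = 0\<close> lets
  \<open>map_poly D\<close> act coefficientwise.\<close>
proof (cases "Vector_Spaces.linear smul smul D")
  case True
  interpret D: Vector_Spaces.linear smul smul D by (fact True)
  \<comment> \<open>Compare coefficients of each power of the bracket variable: linearity pulls the
    nonzero factor \<open>1 / fact m\<close> out of every term, where it cancels.\<close>
  have bracket: "map_poly D (lambda_bracket smul Y a b)
       = lambda_bracket smul Y (D a) b + parity_sign p (lambda_bracket smul Y a (D b))
     \<longleftrightarrow> (\<forall>m. D (Y a (int m) b) = Y (D a) (int m) b + parity_sign p (Y a (int m) (D b)))"
    for p a b
    by (simp add: poly_eq_iff coeff_map_poly D.zero coeff_lambda_bracket coeff_parity_sign
        D.scale parity_sign_scale scale_right_distrib[symmetric])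
  have split: "(\<forall>n\<ge>-1. P n) \<longleftrightarrow> P (-1) \<and> (\<forall>m. P (int m))" for P :: "int \<Rightarrow> bool"
  proof safe
    fix n :: int assume P: "P (-1)" "\<forall>m. P (int m)" and n: "n \<ge> -1"
    show "P n"
    proof (cases "n = -1")
      case False
      with n have "n = int (nat n)" by simp
      with P(2) show ?thesis by metis
    qed (use P in simp)
  qed auto
  show ?thesis
    unfolding odd_derivation_def bracket split normal_product_def using True by blast
qed (simp add: odd_derivation_def)

text \<open>Scalars are even, so they pass through \<open>Y\<close> and the parity sign without a
  further sign; linearity of \<open>Y\<close> in each argument then collects the terms.\<close>

lemma odd_derivation_sum:
  assumes D: "\<And>j. j \<in> J \<Longrightarrow> odd_derivation smul V Y (D j)"
  shows "odd_derivation smul V Y (\<lambda>v. \<Sum>j\<in>J. smul (c j) (D j v))"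
  unfolding odd_derivation_iff
proof (intro conjI allI ballI impI)
  have "Vector_Spaces.linear smul smul (D j)" if "j \<in> J" for j
    using D[OF that] by (simp add: odd_derivation_iff)
  then show "Vector_Spaces.linear smul smul (\<lambda>v. \<Sum>j\<in>J. smul (c j) (D j v))"
    by (simp add: Vector_Spaces.linear_iff scale_right_distrib sum.distrib scale_sum_right mult.commute
        vector_space_axioms)
next
  fix p a assume "a \<in> V p"
  then show "(\<Sum>j\<in>J. smul (c j) (D j a)) \<in> V (p + 1)"
    using D unfolding odd_derivation_iff by (intro subspace_sum subspace_scale subspace_V) blast
next
  fix p a b and n :: int assume a: "a \<in> V p" and n: "n \<ge> -1"
  interpret L: Vector_Spaces.linear smul smul "\<lambda>a. Y a n b" by (fact linear_Y_left)
  interpret R: Vector_Spaces.linear smul smul "Y a n" by (fact linear_Y_right)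
  have "(\<Sum>j\<in>J. smul (c j) (D j (Y a n b)))
      = (\<Sum>j\<in>J. smul (c j) (Y (D j a) n b + parity_sign p (Y a n (D j b))))"
    using D a n by (intro sum.cong) (auto simp: odd_derivation_iff)
  then show "(\<Sum>j\<in>J. smul (c j) (D j (Y a n b)))
      = Y (\<Sum>j\<in>J. smul (c j) (D j a)) n b + parity_sign p (Y a n (\<Sum>j\<in>J. smul (c j) (D j b)))"
    by (simp add: L.sum L.scale R.sum R.scale parity_sign_sum parity_sign_scale
        scale_right_distrib sum.distrib)
qed

text \<open>The tuple is a column vector of operators multiplied on the left by the matrix, so
  products of matrices act in the order of a left action. Sums are taken pointwise, with scaling by
  the locale parameter \<open>smul\<close>.\<close>

definition rotate :: "complex ^ 'n ^ 'n \<Rightarrow> ('v \<Rightarrow> 'v) ^ 'n \<Rightarrow> ('v \<Rightarrow> 'v) ^ 'n" where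
  "rotate A D = (\<chi> i. (\<lambda>v. \<Sum>j\<in>UNIV. smul (A $ i $ j) ((D $ j) v)))"

lemma rotate_nth: "rotate A D $ i = (\<lambda>v. \<Sum>j\<in>UNIV. smul (A $ i $ j) ((D $ j) v))"
  by (simp add: rotate_def)

lemma rotate_mat_1: "rotate (mat 1) D = D"
  by (simp add: rotate_def mat_def vec_eq_iff if_distrib[of "\<lambda>c. smul c _"] cong: if_cong)

lemma rotate_mult: "rotate (A ** B) D = rotate A (rotate B D)"
proof -
  have "(rotate (A ** B) D $ i) v = (rotate A (rotate B D) $ i) v" for i v
  proof -
    have "(rotate (A ** B) D $ i) v
        = (\<Sum>j\<in>UNIV. \<Sum>k\<in>UNIV. smul (A $ i $ k * B $ k $ j) ((D $ j) v))"
      by (simp add: rotate_nth matrix_matrix_mult_def scale_sum_left)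
    also have "\<dots> = (rotate A (rotate B D) $ i) v"
      by (subst sum.swap) (simp add: rotate_nth scale_sum_right)
    finally show ?thesis .
  qed
  then show ?thesis by (simp add: vec_eq_iff fun_eq_iff)
qed

lemma rotate_SUSY:
  assumes A: "A ** transpose A = mat 1" and D: "D \<in> SUSY_structures smul V T Y"
  shows "rotate A D \<in> SUSY_structures smul V T Y"
proof -
  have der: "odd_derivation smul V Y (D $ i)" for i
    using D by (simp add: SUSY_structures_def)
  have comm: "(D $ k) ((D $ l) v) + (D $ l) ((D $ k) v) = (if k = l then smul 2 (T v) else 0)"
    for k l v
    using D by (simp add: SUSY_structures_def)
  have lin: "Vector_Spaces.linear smul smul (D $ i)" for i
    using der by (simp add: odd_derivation_iff)
  have prod: "(rotate A D $ i) ((rotate A D $ j) v)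
      = (\<Sum>k\<in>UNIV. \<Sum>l\<in>UNIV. smul (A $ i $ k * A $ j $ l) ((D $ k) ((D $ l) v)))" for i j v
  proof -
    have "(D $ k) (\<Sum>l\<in>UNIV. smul (A $ j $ l) ((D $ l) v))
        = (\<Sum>l\<in>UNIV. smul (A $ j $ l) ((D $ k) ((D $ l) v)))" for k
    proof -
      interpret Dk: Vector_Spaces.linear smul smul "D $ k" by (fact lin)
      show ?thesis by (simp add: Dk.sum Dk.scale)
    qed
    then show ?thesis by (simp add: rotate_nth scale_sum_right)
  qed
  have "(rotate A D $ i) ((rotate A D $ j) v) + (rotate A D $ j) ((rotate A D $ i) v)
      = (if i = j then smul 2 (T v) else 0)" for i j v
  proof -
    \<comment> \<open>Exchanging the summation indices gives both orders of composition the same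
      coefficients, so that the supercommutators of the original tuple appear termwise.\<close>
    have "(rotate A D $ j) ((rotate A D $ i) v)
        = (\<Sum>k\<in>UNIV. \<Sum>l\<in>UNIV. smul (A $ i $ k * A $ j $ l) ((D $ l) ((D $ k) v)))"
      unfolding prod by (subst sum.swap) (simp add: mult.commute)
    then have "(rotate A D $ i) ((rotate A D $ j) v) + (rotate A D $ j) ((rotate A D $ i) v)
        = (\<Sum>k\<in>UNIV. \<Sum>l\<in>UNIV. smul (A $ i $ k * A $ j $ l) (if k = l then smul 2 (T v) else 0))"
      by (simp only: prod sum.distrib[symmetric] scale_right_distrib[symmetric] comm)
    also have "\<dots> = (\<Sum>k\<in>UNIV. smul (A $ i $ k * A $ j $ k) (smul 2 (T v)))"
      by (simp add: if_distrib[of "smul _"] cong: if_cong)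
    \<comment> \<open>After the diagonal terms alone survive, their coefficients add up to the
      product of rows \<open>i\<close> and \<open>j\<close> of \<open>A\<close>.\<close>
    also have "\<dots> = smul ((A ** transpose A) $ i $ j) (smul 2 (T v))"
      by (simp add: matrix_matrix_mult_def transpose_def scale_sum_left sum_distrib_right)
    also have "\<dots> = (if i = j then smul 2 (T v) else 0)"
      by (simp add: A mat_def)
    finally show ?thesis .
  qed
  moreover have "odd_derivation smul V Y (rotate A D $ i)" for i
    unfolding rotate_nth by (intro odd_derivation_sum der)
  ultimately show ?thesis by (simp add: SUSY_structures_def)
qed

end

text \<open>The trivial action would satisfy a bare existence claim; the explicit formula fixes the
  action as the linear change of the tuple by the matrix.\<close>

theorem proposition6p1:
  fixes smul :: "complex \<Rightarrow> 'v::ab_group_add \<Rightarrow> 'v"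
    and V :: "bit \<Rightarrow> 'v set"
    and vac :: 'v
    and T :: "'v \<Rightarrow> 'v"
    and Y :: "'v \<Rightarrow> int \<Rightarrow> 'v \<Rightarrow> 'v"
  assumes "vertex_superalgebra smul V vac T Y"
  shows "\<exists>\<phi>. group_action (orthogonal_group :: (complex ^ 'n ^ 'n) monoid)
               (SUSY_structures smul V T Y) \<phi> \<and>
             (\<forall>A \<in> carrier orthogonal_group. \<forall>D \<in> SUSY_structures smul V T Y. \<forall>i.
               \<phi> A D $ i = (\<lambda>v. \<Sum>j\<in>UNIV. smul (A $ i $ j) ((D $ j) v)))"
proof -
  interpret vertex_superalgebra smul V vac T Y by (fact assms)
  let ?O = "orthogonal_group :: (complex ^ 'n ^ 'n) monoid" and ?S = "SUSY_structures smul V T Y"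
  have "group_action ?O ?S (\<lambda>A. restrict (rotate A) ?S)"
    by (rule group.group_action_restrictI[OF group_orthogonal_group])
      (simp_all add: orthogonal_group_def rotate_SUSY rotate_mat_1 rotate_mult)
  \<comment> \<open>Restriction leaves \<open>rotate A\<close> unchanged on \<open>?S\<close>, where
    the formula is claimed.\<close>
  then show ?thesis
    by (intro exI[of _ "\<lambda>A. restrict (rotate A) ?S"]) (simp add: rotate_nth)
qed

end
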